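(* Let $f(x)=\sum_{\alpha\in A^+}c_\alpha e^{\langle x,\alpha\rangle}+c_\beta e^{\langle x,\beta\rangle}$ be a circuit function with support $A^+\cup\{\beta\}\subset\mathbb{R}^n$, and let $\lambda$ be the unique vector in $\Lambda(A^+,\beta)$. Then $f\in S_{A^+,\beta}$ if and only if $$\check f(x)\ =\ \sum_{\alpha\in A^+}\frac{c_\alpha}{\lambda_\alpha}e^{\langle x,\alpha\rangle}+c_\beta e^{\langle x,\beta\rangle}\ \in\ D_{A^+,\beta}.$$
   Context: For $A^+\subset\mathbb{R}^n$ finite and $\beta\in\mathbb{R}^n$ let $\Lambda(A^+,\beta)=\{\lambda\in\mathbb{R}_{\ge0}^{A^+}:\sum_{\alpha\in A^+}\lambda_\alpha\alpha=\beta,\ \sum_{\alpha\in A^+}\lambda_\alpha=1\}$. A (simplicial) circuit is either a single point, or a set $C^+\cup\{\gamma\}\subset\mathbb{R}^n$ where $C^+$ is a finite affinely independent set with at least two points and $\gamma$ is in the relative interior of the simplex $\mathrm{conv}(C^+)$. A circuit function is an exponential sum whose support is a circuit and whose coefficients at the vertices of the convex hull of the support are positive (the coefficient at the inner point, if any, may have any sign). In the claim, $A^+\cup\{\beta\}$ is a circuit with inner point $\beta$, so $c_\alpha>0$ for all $\alpha\in A^+$, and $\Lambda(A^+,\beta)$ consists of a single vector, with all entries positive. Signed SONC cone: $S_{A^+,\beta}$ is the set of exponential sums $\sum_{\alpha\in A^+}d_\alpha e^{\langle x,\alpha\rangle}+d_\beta e^{\langle x,\beta\rangle}$ with $d_\alpha\ge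 0$ for $\alpha\in A^+$ that are sums of circuit functions with support in $A^+\cup\{\beta\}$ which are nonnegative on $\mathbb{R}^n$. Signed DSONC cone: $D_{A^+,\beta}$ is the set of exponential sums $\sum_{\alpha\in A^+}d_\alpha e^{\langle x,\alpha\rangle}+d_\beta e^{\langle x,\beta\rangle}$ with $d_\alpha\ge0$ for all $\alpha\in A^+$ and such that either $d_\beta\ge0$, or $|d_\beta|\le\prod_{\alpha\in A^+}d_\alpha^{\lambda_\alpha}$ for all $\lambda\in\Lambda(A^+,\beta)$ (convention $0^0=1$). *)

theory Defs
  imports "HOL-Analysis.Analysis"
begin

definition exp_sum :: "(real^'n) set \<Rightarrow> (real^'n \<Rightarrow> real) \<Rightarrow> real^'n \<Rightarrow> real" where
  "exp_sum A c x = (\<Sum>\<alpha>\<in>A. c \<alpha> * exp (x \<bullet> \<alpha>))"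

definition signed_exp_sum ::
    "(real^'n) set \<Rightarrow> real^'n \<Rightarrow> (real^'n \<Rightarrow> real) \<Rightarrow> real \<Rightarrow> real^'n \<Rightarrow> real" where
  "signed_exp_sum A \<beta> d d\<^sub>\<beta> x = (\<Sum>\<alpha>\<in>A. d \<alpha> * exp (x \<bullet> \<alpha>)) + d\<^sub>\<beta> * exp (x \<bullet> \<beta>)"

(* A vector indexed by A is an extensional function on A, so that the set below has at most
   one element (rather than a class of functions agreeing on A) when A is affinely independent. *)
definition Lambda :: "(real^'n) set \<Rightarrow> real^'n \<Rightarrow> (real^'n \<Rightarrow> real) set" where
  "Lambda A \<beta> = {l \<in> A \<rightarrow>\<^sub>E {0..}. (\<Sum>\<alpha>\<in>A. l \<alpha> *\<^sub>R \<alpha>) = \<beta> \<and> (\<Sum>\<alpha>\<in>A. l \<alpha>) = 1}"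

definition circuit_with_inner :: "(real^'n) set \<Rightarrow> real^'n \<Rightarrow> bool" where
  "circuit_with_inner C \<gamma> \<longleftrightarrow>
     finite C \<and> \<not> affine_dependent C \<and> 2 \<le> card C \<and> \<gamma> \<in> rel_interior (convex hull C)"

definition circuit :: "(real^'n) set \<Rightarrow> bool" where
  "circuit S \<longleftrightarrow> (\<exists>\<alpha>. S = {\<alpha>}) \<or> (\<exists>C \<gamma>. circuit_with_inner C \<gamma> \<and> S = C \<union> {\<gamma>})"

(* The coefficient at the inner point may be any real number, including 0. The latter does not
   enlarge the cone of sums of nonnegative circuit functions: a circuit function with inner
   coefficient 0 is a sum of circuit functions supported on single points. *)
definition circuit_function :: "(real^'n) set \<Rightarrow> (real^'n \<Rightarrow> real) \<Rightarrow> bool" where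
  "circuit_function S f \<longleftrightarrow>
     circuit S \<and>
     (\<exists>c. f = exp_sum S c \<and> (\<forall>\<alpha>. \<alpha> extreme_point_of (convex hull S) \<longrightarrow> c \<alpha> > 0))"

(* The empty sum is included, so the zero function belongs to the cone. *)
definition signed_SONC :: "(real^'n) set \<Rightarrow> real^'n \<Rightarrow> (real^'n \<Rightarrow> real) set" where
  "signed_SONC A \<beta> =
     {f. (\<exists>d d\<^sub>\<beta>. f = signed_exp_sum A \<beta> d d\<^sub>\<beta> \<and> (\<forall>\<alpha>\<in>A. d \<alpha> \<ge> 0)) \<and>
         (\<exists>gs. (\<forall>g\<in>set gs. (\<exists>S. S \<subseteq> A \<union> {\<beta>} \<and> circuit_function S g) \<and> (\<forall>x. g x \<ge> 0)) \<and>
               f = (\<lambda>x. \<Sum>g\<leftarrow>gs. g x))}"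

(* Real power of a nonnegative base with the convention 0^0 = 1; HOL has 0 powr 0 = 0. *)
definition rpow :: "real \<Rightarrow> real \<Rightarrow> real" where
  "rpow x a = (if a = 0 then 1 else x powr a)"

definition signed_DSONC :: "(real^'n) set \<Rightarrow> real^'n \<Rightarrow> (real^'n \<Rightarrow> real) set" where
  "signed_DSONC A \<beta> =
     {f. \<exists>d d\<^sub>\<beta>. f = signed_exp_sum A \<beta> d d\<^sub>\<beta> \<and> (\<forall>\<alpha>\<in>A. d \<alpha> \<ge> 0) \<and>
         (d\<^sub>\<beta> \<ge> 0 \<or> (\<forall>l\<in>Lambda A \<beta>. \<bar>d\<^sub>\<beta>\<bar> \<le> (\<Prod>\<alpha>\<in>A. rpow (d \<alpha>) (l \<alpha>))))}"

end

theory Submission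
  imports Defs
begin

text \<open>
  A circuit function on \<open>A \<union> {\<beta>}\<close> lies in the signed SONC cone iff it is nonnegative, since it can
  serve as its own only summand. Nonnegativity is decided by the circuit number
  \<open>\<Prod>\<alpha>\<in>A. (c \<alpha> / l \<alpha>) powr l \<alpha>\<close>: by weighted AM-GM an inner
  coefficient no smaller than minus this number gives a nonnegative function, and affine independence of
  \<open>A\<close> provides a point \<open>x\<close> at which all \<open>c \<alpha> / l \<alpha> * exp (x \<bullet> \<alpha>)\<close> coincide, that is, where AM-GM is
  an equality. On the dual side \<open>l\<close> is
  the only element of \<open>Lambda A \<beta>\<close> and exponential sums determine their coefficients, so membership of
  the rescaled sum in the DSONC cone is the same inequality.
\<close>

section \<open>Linear independence of exponentials\<close>

text \<open>Induction on the number of exponents: growth along a suitable ray isolates one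
  coefficient, which must vanish, and its exponent is removed.\<close>

lemma exp_sums_linear_independent:
  fixes S :: "'a::real_inner set"
  assumes "finite S" and "\<And>x. (\<Sum>s\<in>S. c s * exp (x \<bullet> s)) = 0" and "s \<in> S"
  shows "c s = 0"
  using assms
proof (induction "card S" arbitrary: S s)
  case 0
  then show ?case by simp
next
  case (Suc n)
  have "finite (norm ` S)" "norm ` S \<noteq> {}" using Suc.prems by auto
  then have "Max (norm ` S) \<in> norm ` S" by (rule Max_in)
  then obtain m where m: "m \<in> S" "norm m = Max (norm ` S)" by (metis imageE)
  then have mx: "norm t \<le> norm m" if "t \<in> S" for t
    using that Suc.prems(1) by simp
  \<comment> \<open>In the direction of a vector of maximal norm its own exponential dominates all others,
      by strictness of Cauchy-Schwarz.\<close>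
  have lt: "m \<bullet> t < m \<bullet> m" if t: "t \<in> S - {m}" for t
  proof -
    have "0 < (m - t) \<bullet> (m - t)" using t by auto
    moreover have "t \<bullet> t \<le> m \<bullet> m" using mx[of t] t by (simp add: norm_le)
    ultimately show ?thesis by (simp add: inner_diff inner_commute)
  qed
  have "((\<lambda>r::real. \<Sum>t\<in>S - {m}. c t * exp (r * (m \<bullet> t - m \<bullet> m))) \<longlongrightarrow> (\<Sum>t\<in>S - {m}. c t * 0)) at_top"
  proof (intro tendsto_sum tendsto_mult tendsto_const)
    fix t assume "t \<in> S - {m}"
    then have "m \<bullet> t - m \<bullet> m < 0" using lt by simp
    then have "filterlim (\<lambda>r::real. (m \<bullet> t - m \<bullet> m) * r) at_bot at_top"
      by (intro filterlim_tendsto_neg_mult_at_bot[OF tendsto_const] filterlim_ident)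
    then have "filterlim (\<lambda>r::real. r * (m \<bullet> t - m \<bullet> m)) at_bot at_top"
      by (subst mult.commute)
    then show "((\<lambda>r::real. exp (r * (m \<bullet> t - m \<bullet> m))) \<longlongrightarrow> 0) at_top"
      by (rule filterlim_compose[OF exp_at_bot])
  qed
  \<comment> \<open>Multiplying the vanishing sum at \<open>r *\<^sub>R m\<close> by
    \<open>exp (- r * (m \<bullet> m))\<close> makes the term of \<open>m\<close> constant, so the
    remainder, which tends to 0, equals \<open>- c m\<close> for every \<open>r\<close>.\<close>
  moreover have "(\<Sum>t\<in>S - {m}. c t * exp (r * (m \<bullet> t - m \<bullet> m))) = - c m" for r
  proof -
    have "0 = exp (- r * (m \<bullet> m)) * (\<Sum>t\<in>S. c t * exp ((r *\<^sub>R m) \<bullet> t))"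
      unfolding Suc.prems(2) by simp
    also have "\<dots> = (\<Sum>t\<in>S. c t * exp (r * (m \<bullet> t - m \<bullet> m)))"
      unfolding sum_distrib_left
    proof (intro sum.cong refl)
      fix t
      have "exp (- r * (m \<bullet> m)) * exp ((r *\<^sub>R m) \<bullet> t) = exp (r * (m \<bullet> t - m \<bullet> m))"
        by (simp add: mult_exp_exp right_diff_distrib)
      then show "exp (- r * (m \<bullet> m)) * (c t * exp ((r *\<^sub>R m) \<bullet> t)) =
          c t * exp (r * (m \<bullet> t - m \<bullet> m))"
        by simp
    qed
    also have "\<dots> = c m + (\<Sum>t\<in>S - {m}. c t * exp (r * (m \<bullet> t - m \<bullet> m)))"
      using m(1) Suc.prems(1) by (simp add: sum.remove)
    finally show ?thesis by simp
  qed
  ultimately have cm: "c m = 0" by (simp add: tendsto_const_iff)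
  show ?case
  proof (cases "s = m")
    case False
    have "(\<Sum>t\<in>S - {m}. c t * exp (x \<bullet> t)) = 0" for x
      using Suc.prems(1) Suc.prems(2)[of x] m(1) cm by (simp add: sum.remove)
    then show ?thesis
      using Suc.hyps(1)[of "S - {m}" s] Suc.hyps(2) Suc.prems(1,3) m(1) False by simp
  qed (use cm in simp)
qed

lemma exp_sum_coeffs_unique:
  fixes S :: "'a::real_inner set"
  assumes "finite S" and "\<And>x. (\<Sum>s\<in>S. c s * exp (x \<bullet> s)) = (\<Sum>s\<in>S. d s * exp (x \<bullet> s))"
    and "s \<in> S"
  shows "c s = d s"
proof -
  have "(\<Sum>s\<in>S. (c s - d s) * exp (x \<bullet> s)) = 0" for x
    unfolding left_diff_distrib sum_subtractf assms(2) by simp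
  from exp_sums_linear_independent[OF assms(1) this assms(3)] show ?thesis by simp
qed

lemma signed_exp_sum_eq_exp_sum:
  assumes "finite A" and "\<beta> \<notin> A"
  shows "signed_exp_sum A \<beta> d b = exp_sum (insert \<beta> A) (d(\<beta> := b))"
proof
  fix x
  have "(\<Sum>\<alpha>\<in>A. (d(\<beta> := b)) \<alpha> * exp (x \<bullet> \<alpha>)) = (\<Sum>\<alpha>\<in>A. d \<alpha> * exp (x \<bullet> \<alpha>))"
    using assms by (intro sum.cong) auto
  then show "signed_exp_sum A \<beta> d b x = exp_sum (insert \<beta> A) (d(\<beta> := b)) x"
    using assms by (simp add: signed_exp_sum_def exp_sum_def)
qed

section \<open>Affine independence and barycentric coordinates\<close>

text \<open>The differences from a base point \<open>a\<close> are linearly independent, so some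
  linear functional takes prescribed values on them; \<open>t\<close> absorbs the offset at
  \<open>a\<close>. This later supplies the point where AM-GM is an equality.\<close>

lemma affine_independent_interpolation:
  fixes A :: "'a::euclidean_space set" and g :: "'a \<Rightarrow> real"
  assumes "\<not> affine_dependent A"
  obtains x t where "\<And>\<alpha>. \<alpha> \<in> A \<Longrightarrow> x \<bullet> \<alpha> = t + g \<alpha>"
proof (cases "A = {}")
  case True
  then show ?thesis using that by simp
next
  case False
  then obtain a where a: "a \<in> A" by auto
  have "independent ((\<lambda>\<alpha>. - a + \<alpha>) ` (A - {a}))"
    using affine_dependent_iff_dependent2[OF a] assms by simp
  from linear_independent_extend[OF this, of "\<lambda>y. g (y + a) - g a"]
  obtain h :: "'a \<Rightarrow> real" where h: "linear h"
    "\<forall>y\<in>(\<lambda>\<alpha>. - a + \<alpha>) ` (A - {a}). h y = g (y + a) - g a"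
    by blast
  \<comment> \<open>\<open>adjoint h 1\<close> is the Riesz representative of the functional
    \<open>h\<close>.\<close>
  have adj: "adjoint h 1 \<bullet> y = h y" for y
    using adjoint_works[OF h(1), of y 1] by (simp add: inner_commute)
  have "adjoint h 1 \<bullet> \<alpha> = (h a - g a) + g \<alpha>" if "\<alpha> \<in> A" for \<alpha>
  proof (cases "\<alpha> = a")
    case False
    then have "h (- a + \<alpha>) = g \<alpha> - g a" using h(2) that by auto
    then show ?thesis by (simp add: adj linear_diff[OF h(1)])
  qed (simp add: adj)
  then show ?thesis by (rule that)
qed

text \<open>The difference of two elements has coefficient sum 0 and represents the zero vector, so
  a nonzero entry would be an affine dependence. Off \<open>A\<close> both are
  \<open>undefined\<close> by extensionality.\<close>

lemma Lambda_unique: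
  assumes "finite A" and "\<not> affine_dependent A" and "l \<in> Lambda A \<beta>" and "k \<in> Lambda A \<beta>"
  shows "k = l"
proof
  fix \<alpha>
  have ext: "k \<in> extensional A" "l \<in> extensional A"
    using assms(3,4) by (auto simp: Lambda_def PiE_def)
  have "(\<Sum>v\<in>A. k v - l v) = 0" "(\<Sum>v\<in>A. (k v - l v) *\<^sub>R v) = 0"
    using assms(3,4) by (simp_all add: Lambda_def sum_subtractf scaleR_diff_left)
  then have "k \<alpha> = l \<alpha>" if "\<alpha> \<in> A"
    using assms(2) affine_dependent_explicit_finite[OF assms(1)] that by fastforce
  then show "k \<alpha> = l \<alpha>"
    using ext by (cases "\<alpha> \<in> A") (auto simp: extensional_def)
qed

text \<open>A relative interior point of a simplex has some all-positive barycentric coordinates,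
  and by uniqueness these are \<open>l\<close>.\<close>

lemma circuit_with_inner_Lambda_pos:
  assumes "circuit_with_inner A \<beta>" and "l \<in> Lambda A \<beta>" and "\<alpha> \<in> A"
  shows "l \<alpha> > 0"
proof -
  obtain u where u: "\<forall>x\<in>A. 0 < u x" "sum u A = 1" "(\<Sum>x\<in>A. u x *\<^sub>R x) = \<beta>"
    using assms(1) rel_interior_convex_hull_explicit[of A]
    by (auto simp: circuit_with_inner_def)
  then have "restrict u A \<in> Lambda A \<beta>" by (auto simp: Lambda_def intro: less_imp_le)
  then have "restrict u A = l"
    using Lambda_unique assms(1,2) by (metis circuit_with_inner_def)
  then show ?thesis using u(1) assms(3) by auto
qed

text \<open>Otherwise the indicator of \<beta> would be a vector in \<open>Lambda A \<beta>\<close>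
  with a zero entry at a second vertex.\<close>

lemma circuit_with_inner_notin:
  assumes "circuit_with_inner A \<beta>"
  shows "\<beta> \<notin> A"
proof
  assume b: "\<beta> \<in> A"
  have fin: "finite A" and "A \<noteq> {\<beta>}"
    using assms by (auto simp: circuit_with_inner_def)
  then obtain \<alpha> where \<alpha>: "\<alpha> \<in> A" "\<alpha> \<noteq> \<beta>" using b by blast
  define k where "k = restrict (\<lambda>v. if v = \<beta> then 1 else 0 :: real) A"
  have "(\<Sum>v\<in>A. k v *\<^sub>R v) = (\<Sum>v\<in>A. if v = \<beta> then \<beta> else 0)"
    by (intro sum.cong) (auto simp: k_def)
  then have "k \<in> Lambda A \<beta>" using fin b by (auto simp: Lambda_def k_def)
  from circuit_with_inner_Lambda_pos[OF assms this \<alpha>(1)] show False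
    using \<alpha> by (simp add: k_def)
qed

lemma circuit_with_inner_extreme_point_iff:
  assumes "circuit_with_inner A \<beta>"
  shows "\<alpha> extreme_point_of (convex hull (insert \<beta> A)) \<longleftrightarrow> \<alpha> \<in> A"
proof -
  have "\<beta> \<in> convex hull A"
    using assms rel_interior_subset by (auto simp: circuit_with_inner_def)
  then have "convex hull (insert \<beta> A) = convex hull A" by (rule hull_redundant)
  then show ?thesis
    using assms extreme_point_of_convex_hull_affine_independent
    by (auto simp: circuit_with_inner_def)
qed

section \<open>Circuit functions and membership in the two cones\<close>

text \<open>Circuit functions and the cones are defined through functions with existentially
  quantified coefficients; this identifies those coefficients with the given ones.\<close>

lemma signed_exp_sum_coeffs_unique:
  assumes "circuit_with_inner A \<beta>" and "signed_exp_sum A \<beta> c b = signed_exp_sum A \<beta> c' b'"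
  shows "b = b'" and "\<alpha> \<in> A \<Longrightarrow> c \<alpha> = c' \<alpha>"
proof -
  have fin: "finite A" and nb: "\<beta> \<notin> A"
    using assms(1) circuit_with_inner_notin by (auto simp: circuit_with_inner_def)
  have "exp_sum (insert \<beta> A) (c(\<beta> := b)) x = exp_sum (insert \<beta> A) (c'(\<beta> := b')) x" for x
    using assms(2) by (simp add: signed_exp_sum_eq_exp_sum[OF fin nb])
  then have eq: "(c(\<beta> := b)) s = (c'(\<beta> := b')) s" if "s \<in> insert \<beta> A" for s
    using exp_sum_coeffs_unique[OF _ _ that] fin unfolding exp_sum_def by blast
  from eq[of \<beta>] show "b = b'" by simp
  assume "\<alpha> \<in> A"
  with eq[of \<alpha>] nb show "c \<alpha> = c' \<alpha>" by (auto split: if_splits)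
qed

lemma circuit_function_iff:
  assumes "circuit_with_inner A \<beta>"
  shows "circuit_function (insert \<beta> A) (signed_exp_sum A \<beta> c b) \<longleftrightarrow> (\<forall>\<alpha>\<in>A. c \<alpha> > 0)"
proof
  have fin: "finite A" and nb: "\<beta> \<notin> A"
    using assms circuit_with_inner_notin by (auto simp: circuit_with_inner_def)
  {
    assume "circuit_function (insert \<beta> A) (signed_exp_sum A \<beta> c b)"
    then obtain d where d: "signed_exp_sum A \<beta> c b = exp_sum (insert \<beta> A) d" "\<forall>\<alpha>\<in>A. d \<alpha> > 0"
      by (auto simp: circuit_function_def circuit_with_inner_extreme_point_iff[OF assms])
    then have "signed_exp_sum A \<beta> c b = signed_exp_sum A \<beta> d (d \<beta>)"
      by (simp add: signed_exp_sum_eq_exp_sum[OF fin nb])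
    from signed_exp_sum_coeffs_unique(2)[OF assms this] d(2) show "\<forall>\<alpha>\<in>A. c \<alpha> > 0" by auto
  next
    assume "\<forall>\<alpha>\<in>A. c \<alpha> > 0"
    then have "\<forall>\<alpha>\<in>A. (c(\<beta> := b)) \<alpha> > 0" using nb by auto
    moreover have "circuit (insert \<beta> A)" using assms by (auto simp: circuit_def)
    ultimately show "circuit_function (insert \<beta> A) (signed_exp_sum A \<beta> c b)"
      by (auto simp: circuit_function_def circuit_with_inner_extreme_point_iff[OF assms]
          signed_exp_sum_eq_exp_sum[OF fin nb])
  }
qed

lemma signed_SONC_iff_nonneg:
  assumes "circuit_with_inner A \<beta>" and "\<And>\<alpha>. \<alpha> \<in> A \<Longrightarrow> c \<alpha> > 0"
  shows "signed_exp_sum A \<beta> c b \<in> signed_SONC A \<beta> \<longleftrightarrow> (\<forall>x. signed_exp_sum A \<beta> c b x \<ge> 0)"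
proof
  assume "signed_exp_sum A \<beta> c b \<in> signed_SONC A \<beta>"
  then obtain gs where "\<forall>g\<in>set gs. \<forall>x. g x \<ge> 0"
    "signed_exp_sum A \<beta> c b = (\<lambda>x. \<Sum>g\<leftarrow>gs. g x)"
    unfolding signed_SONC_def by blast
  then show "\<forall>x. signed_exp_sum A \<beta> c b x \<ge> 0" by (auto intro!: sum_list_nonneg)
next
  assume nn: "\<forall>x. signed_exp_sum A \<beta> c b x \<ge> 0"
  have "circuit_function (insert \<beta> A) (signed_exp_sum A \<beta> c b)"
    using assms by (simp add: circuit_function_iff)
  then have "\<exists>gs. (\<forall>g\<in>set gs. (\<exists>S. S \<subseteq> A \<union> {\<beta>} \<and> circuit_function S g) \<and> (\<forall>x. g x \<ge> 0)) \<and>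
      signed_exp_sum A \<beta> c b = (\<lambda>x. \<Sum>g\<leftarrow>gs. g x)"
    using nn by (intro exI[of _ "[signed_exp_sum A \<beta> c b]"]) auto
  then show "signed_exp_sum A \<beta> c b \<in> signed_SONC A \<beta>"
    using assms(2) unfolding signed_SONC_def by (blast intro: less_imp_le)
qed

lemma signed_DSONC_iff:
  assumes "circuit_with_inner A \<beta>" and "l \<in> Lambda A \<beta>" and "\<And>\<alpha>. \<alpha> \<in> A \<Longrightarrow> d \<alpha> \<ge> 0"
  shows "signed_exp_sum A \<beta> d b \<in> signed_DSONC A \<beta> \<longleftrightarrow>
    b \<ge> 0 \<or> \<bar>b\<bar> \<le> (\<Prod>\<alpha>\<in>A. rpow (d \<alpha>) (l \<alpha>))"
proof -
  have L: "Lambda A \<beta> = {l}"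
    using assms(1,2) Lambda_unique by (auto simp: circuit_with_inner_def)
  show ?thesis
  proof
    assume "signed_exp_sum A \<beta> d b \<in> signed_DSONC A \<beta>"
    then obtain d' b' where eq: "signed_exp_sum A \<beta> d b = signed_exp_sum A \<beta> d' b'"
      and le: "b' \<ge> 0 \<or> \<bar>b'\<bar> \<le> (\<Prod>\<alpha>\<in>A. rpow (d' \<alpha>) (l \<alpha>))"
      by (auto simp: signed_DSONC_def L)
    \<comment> \<open>The coefficients \<open>d\<close> and \<open>d'\<close> are known to agree on
      \<open>A\<close> only, which is all that the product depends on.\<close>
    moreover have "(\<Prod>\<alpha>\<in>A. rpow (d' \<alpha>) (l \<alpha>)) = (\<Prod>\<alpha>\<in>A. rpow (d \<alpha>) (l \<alpha>))"
      using signed_exp_sum_coeffs_unique(2)[OF assms(1) eq] by (intro prod.cong) auto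
    ultimately show "b \<ge> 0 \<or> \<bar>b\<bar> \<le> (\<Prod>\<alpha>\<in>A. rpow (d \<alpha>) (l \<alpha>))"
      using signed_exp_sum_coeffs_unique(1)[OF assms(1) eq] by simp
  next
    assume "b \<ge> 0 \<or> \<bar>b\<bar> \<le> (\<Prod>\<alpha>\<in>A. rpow (d \<alpha>) (l \<alpha>))"
    then show "signed_exp_sum A \<beta> d b \<in> signed_DSONC A \<beta>"
      using assms(3) by (auto simp: signed_DSONC_def L)
  qed
qed

section \<open>The circuit number criterion\<close>

text \<open>The bound is on \<open>- b\<close> instead of \<open>\<bar>b\<bar>\<close>, so that it
  also covers \<open>b \<ge> 0\<close>, where it holds because the product is positive.\<close>

lemma nonneg_iff_circuit_number:
  assumes "circuit_with_inner A \<beta>" and "l \<in> Lambda A \<beta>" and cpos: "\<And>\<alpha>. \<alpha> \<in> A \<Longrightarrow> c \<alpha> > 0"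
  shows "(\<forall>x. signed_exp_sum A \<beta> c b x \<ge> 0) \<longleftrightarrow> - b \<le> (\<Prod>\<alpha>\<in>A. rpow (c \<alpha> / l \<alpha>) (l \<alpha>))"
proof -
  have fin: "finite A" and indep: "\<not> affine_dependent A" and ne: "A \<noteq> {}"
    using assms(1) by (auto simp: circuit_with_inner_def)
  have lpos: "l \<alpha> > 0" if "\<alpha> \<in> A" for \<alpha>
    using circuit_with_inner_Lambda_pos[OF assms(1,2) that] .
  have l1: "(\<Sum>\<alpha>\<in>A. l \<alpha>) = 1" and lb: "(\<Sum>\<alpha>\<in>A. l \<alpha> *\<^sub>R \<alpha>) = \<beta>"
    using assms(2) by (auto simp: Lambda_def)
  \<comment> \<open>The logarithm of the circuit number.\<close>
  define K where "K = (\<Sum>\<alpha>\<in>A. l \<alpha> * ln (c \<alpha> / l \<alpha>))"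
  \<comment> \<open>Chosen so that the terms over \<open>A\<close> become an
    \<open>l\<close>-weighted mean of the values \<open>exp (y x \<alpha>)\<close>.\<close>
  define y where "y x \<alpha> = x \<bullet> \<alpha> + ln (c \<alpha> / l \<alpha>)" for x \<alpha>
  have prod: "(\<Prod>\<alpha>\<in>A. rpow (c \<alpha> / l \<alpha>) (l \<alpha>)) = exp K"
    unfolding K_def exp_sum[OF fin]
  proof (intro prod.cong refl)
    fix \<alpha> assume \<alpha>: "\<alpha> \<in> A"
    show "rpow (c \<alpha> / l \<alpha>) (l \<alpha>) = exp (l \<alpha> * ln (c \<alpha> / l \<alpha>))"
      using lpos[OF \<alpha>] cpos[OF \<alpha>] by (simp add: rpow_def powr_def)
  qed
  have summand: "c \<alpha> * exp (x \<bullet> \<alpha>) = l \<alpha> * exp (y x \<alpha>)" if "\<alpha> \<in> A" for x \<alpha>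
    using lpos[OF that] cpos[OF that] by (simp add: y_def exp_add)
  have f: "signed_exp_sum A \<beta> c b x = (\<Sum>\<alpha>\<in>A. l \<alpha> * exp (y x \<alpha>)) + b * exp (x \<bullet> \<beta>)" for x
    by (simp add: signed_exp_sum_def summand)
  \<comment> \<open>Because \<open>l\<close> represents \<beta>, the weighted mean of the exponents
    depends on \<open>x\<close> only through \<open>x \<bullet> \<beta>\<close>.\<close>
  have mean: "(\<Sum>\<alpha>\<in>A. l \<alpha> * y x \<alpha>) = K + x \<bullet> \<beta>" for x
    by (simp add: y_def K_def lb[symmetric] distrib_left sum.distrib inner_sum_right)
  show ?thesis unfolding prod
  proof
    assume nn: "\<forall>x. signed_exp_sum A \<beta> c b x \<ge> 0"
    \<comment> \<open>At this \<open>x\<close> all \<open>y x \<alpha>\<close> coincide, so the mean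
      of the exponentials is the exponential of the mean, and the sign of the function there is that
      of \<open>exp K + b\<close>.\<close>
    obtain x t where "\<And>\<alpha>. \<alpha> \<in> A \<Longrightarrow> x \<bullet> \<alpha> = t + - ln (c \<alpha> / l \<alpha>)"
      using affine_independent_interpolation[OF indep, of "\<lambda>\<alpha>. - ln (c \<alpha> / l \<alpha>)"] by blast
    then have yt: "y x \<alpha> = t" if "\<alpha> \<in> A" for \<alpha> using that by (simp add: y_def)
    have "t = K + x \<bullet> \<beta>"
      using mean[of x] by (simp add: yt l1 flip: sum_distrib_right)
    then have "signed_exp_sum A \<beta> c b x = (exp K + b) * exp (x \<bullet> \<beta>)"
      by (simp add: f yt l1 exp_add distrib_right flip: sum_distrib_right)
    then have "0 \<le> (exp K + b) * exp (x \<bullet> \<beta>)" using nn by metis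
    then show "- b \<le> exp K" by (simp add: zero_le_mult_iff)
  next
    assume le: "- b \<le> exp K"
    show "\<forall>x. signed_exp_sum A \<beta> c b x \<ge> 0"
    proof
      fix x
      \<comment> \<open>Jensen's inequality for \<open>exp\<close>, which is weighted AM-GM in
        logarithmic form.\<close>
      have "exp (\<Sum>\<alpha>\<in>A. l \<alpha> *\<^sub>R y x \<alpha>) \<le> (\<Sum>\<alpha>\<in>A. l \<alpha> * exp (y x \<alpha>))"
        using lpos l1
        by (intro convex_on_sum[OF fin ne exp_convex]) (auto intro: less_imp_le)
      then have "exp K * exp (x \<bullet> \<beta>) \<le> (\<Sum>\<alpha>\<in>A. l \<alpha> * exp (y x \<alpha>))"
        by (simp add: mean exp_add)
      moreover have "- b * exp (x \<bullet> \<beta>) \<le> exp K * exp (x \<bullet> \<beta>)"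
        using le by (intro mult_right_mono) auto
      ultimately show "signed_exp_sum A \<beta> c b x \<ge> 0" by (simp add: f)
    qed
  qed
qed

theorem corollary4p6:
  fixes A :: "(real^'n) set" and \<beta> :: "real^'n"
    and c :: "real^'n \<Rightarrow> real" and c\<^sub>\<beta> :: real
    and l :: "real^'n \<Rightarrow> real"
  assumes "circuit_with_inner A \<beta>"
    and "circuit_function (A \<union> {\<beta>}) (\<lambda>x. (\<Sum>\<alpha>\<in>A. c \<alpha> * exp (x \<bullet> \<alpha>)) + c\<^sub>\<beta> * exp (x \<bullet> \<beta>))"
    and "l \<in> Lambda A \<beta>"
  shows "(\<lambda>x. (\<Sum>\<alpha>\<in>A. c \<alpha> * exp (x \<bullet> \<alpha>)) + c\<^sub>\<beta> * exp (x \<bullet> \<beta>)) \<in> signed_SONC A \<beta> \<longleftrightarrow>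
         (\<lambda>x. (\<Sum>\<alpha>\<in>A. c \<alpha> / l \<alpha> * exp (x \<bullet> \<alpha>)) + c\<^sub>\<beta> * exp (x \<bullet> \<beta>)) \<in> signed_DSONC A \<beta>"
proof -
  have cpos: "c \<alpha> > 0" if "\<alpha> \<in> A" for \<alpha>
    using assms(2) that circuit_function_iff[OF assms(1), of c c\<^sub>\<beta>]
    by (simp add: signed_exp_sum_def[abs_def])
  have lpos: "l \<alpha> > 0" if "\<alpha> \<in> A" for \<alpha>
    using circuit_with_inner_Lambda_pos[OF assms(1,3) that] .
  have nn: "c \<alpha> / l \<alpha> \<ge> 0" if "\<alpha> \<in> A" for \<alpha>
    using cpos[OF that] lpos[OF that] by simp
  \<comment> \<open>Nonnegativity of the circuit number reconciles the two criteria: the single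
    bound on \<open>- b\<close> is then equivalent to the disjunction in the DSONC
    condition.\<close>
  have "(\<Prod>\<alpha>\<in>A. rpow (c \<alpha> / l \<alpha>) (l \<alpha>)) \<ge> 0"
    by (intro prod_nonneg) (simp add: rpow_def)
  then have "signed_exp_sum A \<beta> c c\<^sub>\<beta> \<in> signed_SONC A \<beta> \<longleftrightarrow>
      signed_exp_sum A \<beta> (\<lambda>\<alpha>. c \<alpha> / l \<alpha>) c\<^sub>\<beta> \<in> signed_DSONC A \<beta>"
    using signed_SONC_iff_nonneg[OF assms(1) cpos] nonneg_iff_circuit_number[OF assms(1,3) cpos]
      signed_DSONC_iff[OF assms(1,3) nn] by auto
  then show ?thesis by (simp add: signed_exp_sum_def[abs_def])
qed

end
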